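(* Let $\mathcal G=(\mathcal V,\mathcal E)$ be a directed graph with exactly one cycle. Then the steady-state gas flow model for mixtures on $\mathcal G$ admits at least one solution.
   Context: Network: $\mathcal G=(\mathcal V,\mathcal E)$ is a connected directed graph, $\mathcal E\subseteq\mathcal V\times\mathcal V$. An edge is $e=(f(e),h(e))$ with start node $f(e)$ and end node $h(e)$; $\mathcal E(v)$ is the set of edges incident to $v$. Cycles are understood irrespective of edge orientation. The incidence matrix $A$ has entries $a(v,e)=-1$ if $v=f(e)$, $a(v,e)=1$ if $v=h(e)$, and $a(v,e)=0$ otherwise. Data: constants $\lambda_{\mathrm{Fr}}>0$ (friction factor), $D$ (pipe diameter), $\sigma_{\mathrm{H}_2}$, $\sigma_{\mathrm{NG}}$ (speeds of sound in hydrogen and natural gas), and pipe lengths $L^e$. $\mathcal V$ is the disjoint union of the supply nodes $\mathcal V_{<0}$ and the demand nodes $\mathcal V_{\ge0}$. Loads $b_v$ are given for all $v\in\mathcal V$, with $b_v<0$ for $v\in\mathcal V_{<0}$, $b_v\ge0$ for $v\in\mathcal V_{\ge0}$, and $\sum_{v\in\mathcal V}b_v=0$. Supply compositions $\zeta_v$ (hydrogen fractions) are given for $v\in\mathcal V_{<0}$. At one fixed node $v^\ast\in\mathcal V$ a pressure $p^\ast$ is prescribed. Notation: $\alpha^+=\max\{\alpha,0\}$, $\alpha^-=\max\{-\alpha,0\}$; $\sigma(\eta)=\eta\,\sigma_{\mathrm{H}_2}^2+(1-\eta)\,\sigma_{\mathrm{NG}}^2$; and $$\tilde\sigma(\eta_{f(e)},\eta_{h(e)},q_e)=-\frac{\lambda_{\mathrm{Fr}}}{D}L^e\Big[\tfrac12\Big(\tfrac{|q_e|}{q_e}+1\Big)\sigma(\eta_{f(e)})-\tfrac12\Big(\tfrac{|q_e|}{q_e}-1\Big)\sigma(\eta_{h(e)})\Big],$$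 where the product $\tilde\sigma(\eta_{f(e)},\eta_{h(e)},q_e)\,q_e|q_e|$ has a removable singularity at $q_e=0$ (with value $0$). The composition on an edge is $\eta_e=\eta_{f(e)}$ if $q_e\ge0$ and $\eta_e=\eta_{h(e)}$ if $q_e<0$. The steady-state gas flow model for mixtures: the unknowns are the flows $q_e$ ($e\in\mathcal E$), the nodal compositions $\eta_v$ and the nodal pressures $p_v$ ($v\in\mathcal V$), with $p_{v^\ast}=p^\ast$, and a solution satisfies $$p_{h(e)}^2-p_{f(e)}^2=\tilde\sigma(\eta_{f(e)},\eta_{h(e)},q_e)\,q_e|q_e|\quad\text{for all } e\in\mathcal E,$$ $$\sum_{e\in\mathcal E(v)}a(v,e)q_e=b_v\quad\text{for all } v\in\mathcal V,$$ $$\eta_v=\frac{\sum_{e\in\mathcal E(v)}\eta_e\,(a(v,e)q_e)^+ +\zeta_v b_v^-}{\sum_{e\in\mathcal E(v)}(a(v,e)q_e)^+ + b_v^-}\quad\text{for all } v\in\mathcal V,$$ where the term $\zeta_v b_v^-$ is present only at supply nodes (it is $0$ if $b_v\ge0$).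
   Formalization: For small prescribed pressure p* real nodal pressures need not exist; proved instead: a solution for every p* with the squared pressures as unknowns (possibly negative), and a solution with real pressures for all sufficiently large p*. *)

theory Defs
  imports Complex_Main "Graph_Theory.Digraph_Component"
begin

text \<open>
  A network is a \<^typ>\<open>'v pair_pre_digraph\<close>: the edges are pairs of nodes, and the start and end
  node of an edge are its two projections.

  Cycles are understood irrespective of edge orientation: a set of edges is a cycle if it becomes
  the edge set of a directed cycle after the edges in some set \<open>R\<close> have been reversed. As an edge
  has one direction in \<open>reorient G R\<close>, running back and forth along it is no cycle, whereas
  two antiparallel edges \<open>(u, v)\<close> and \<open>(v, u)\<close> do form one.
\<close>

definition reorient :: "'v pair_pre_digraph \<Rightarrow> ('v \<times> 'v) set \<Rightarrow> ('v, 'v \<times> 'v) pre_digraph" where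
  "reorient G R = \<lparr> verts = pverts G, arcs = parcs G,
     tail = (\<lambda>e. if e \<in> R then snd e else fst e),
     head = (\<lambda>e. if e \<in> R then fst e else snd e) \<rparr>"

definition undirected_cycle :: "'v pair_pre_digraph \<Rightarrow> ('v \<times> 'v) set \<Rightarrow> bool" where
  "undirected_cycle G C \<longleftrightarrow> (\<exists>R p. pre_digraph.cycle (reorient G R) p \<and> set p = C)"

definition incident_edges :: "'v pair_pre_digraph \<Rightarrow> 'v \<Rightarrow> ('v \<times> 'v) set" where
  "incident_edges G v = {e \<in> parcs G. fst e = v \<or> snd e = v}"

definition incidence :: "'v \<Rightarrow> 'v \<times> 'v \<Rightarrow> real" where
  "incidence v e = (if v = fst e then - 1 else if v = snd e then 1 else 0)"

definition pos_part :: "real \<Rightarrow> real" where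
  "pos_part x = max x 0"

definition neg_part :: "real \<Rightarrow> real" where
  "neg_part x = max (- x) 0"

text \<open>
  The supply nodes are the nodes with negative load; \<open>supply_comp\<close> (the hydrogen fraction of the
  injected gas) is relevant only there.
\<close>

record 'v gas_data =
  friction :: real
  diameter :: real
  sound_H2 :: real
  sound_NG :: real
  pipe_length :: "'v \<times> 'v \<Rightarrow> real"
  load :: "'v \<Rightarrow> real"
  supply_comp :: "'v \<Rightarrow> real"

definition mix_sigma :: "'v gas_data \<Rightarrow> real \<Rightarrow> real" where
  "mix_sigma N \<eta> = \<eta> * (sound_H2 N)\<^sup>2 + (1 - \<eta>) * (sound_NG N)\<^sup>2"

text \<open>
  At \<open>q = 0\<close> the coefficient below is some finite number, so that the pressure law, which multiplies
  it by \<open>q * \<bar>q\<bar>\<close>, takes the value \<open>0\<close> of its removable singularity.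
\<close>

definition edge_sigma :: "'v gas_data \<Rightarrow> 'v \<times> 'v \<Rightarrow> real \<Rightarrow> real \<Rightarrow> real \<Rightarrow> real" where
  "edge_sigma N e \<eta>f \<eta>h q =
     - (friction N / diameter N) * pipe_length N e *
       (1/2 * (\<bar>q\<bar> / q + 1) * mix_sigma N \<eta>f - 1/2 * (\<bar>q\<bar> / q - 1) * mix_sigma N \<eta>h)"

definition edge_comp :: "('v \<times> 'v \<Rightarrow> real) \<Rightarrow> ('v \<Rightarrow> real) \<Rightarrow> 'v \<times> 'v \<Rightarrow> real" where
  "edge_comp q \<eta> e = (if q e \<ge> 0 then \<eta> (fst e) else \<eta> (snd e))"

text \<open>
  The model equations, with \<open>P v\<close> in place of the squared pressure at \<open>v\<close>.

  The denominator in the mixing equation vanishes exactly if \<open>v\<close> has zero load and no flow on its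
  incident edges. The quotient 0/0 is then undefined on paper and equals 0 here, which sets
  \<open>\<eta> v = 0\<close>; in this situation no other equation depends on the value of \<open>\<eta> v\<close>.
\<close>

definition mixture_flow_equations ::
  "'v pair_pre_digraph \<Rightarrow> 'v gas_data \<Rightarrow> ('v \<times> 'v \<Rightarrow> real) \<Rightarrow> ('v \<Rightarrow> real) \<Rightarrow> ('v \<Rightarrow> real) \<Rightarrow> bool"
where
  "mixture_flow_equations G N q \<eta> P \<longleftrightarrow>
     (\<forall>e\<in>parcs G. P (snd e) - P (fst e)
        = edge_sigma N e (\<eta> (fst e)) (\<eta> (snd e)) (q e) * (q e * \<bar>q e\<bar>)) \<and>
     (\<forall>v\<in>pverts G. (\<Sum>e\<in>incident_edges G v. incidence v e * q e) = load N v) \<and>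
     (\<forall>v\<in>pverts G. \<eta> v =
        ((\<Sum>e\<in>incident_edges G v. edge_comp q \<eta> e * pos_part (incidence v e * q e))
           + supply_comp N v * neg_part (load N v))
        / ((\<Sum>e\<in>incident_edges G v. pos_part (incidence v e * q e)) + neg_part (load N v)))"

definition steady_state_solution ::
  "'v pair_pre_digraph \<Rightarrow> 'v gas_data \<Rightarrow> 'v \<Rightarrow> real \<Rightarrow>
   ('v \<times> 'v \<Rightarrow> real) \<Rightarrow> ('v \<Rightarrow> real) \<Rightarrow> ('v \<Rightarrow> real) \<Rightarrow> bool"
where
  "steady_state_solution G N vstar pstar q \<eta> p \<longleftrightarrow>
     p vstar = pstar \<and> mixture_flow_equations G N q \<eta> (\<lambda>v. (p v)\<^sup>2)"

text \<open>
  The pressures enter the model only through their squares, and the equations fix the differences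
  of the squares. If the prescribed pressure is too small for the loads, some of the resulting
  squares are negative and no real pressures exist. The following variant takes the squared
  pressures as unknowns; a solution of it with \<open>P \<ge> 0\<close> and \<open>pstar \<ge> 0\<close> yields one in the above sense
  with \<open>p v = sqrt (P v)\<close>.
\<close>

definition steady_state_solution_squared ::
  "'v pair_pre_digraph \<Rightarrow> 'v gas_data \<Rightarrow> 'v \<Rightarrow> real \<Rightarrow>
   ('v \<times> 'v \<Rightarrow> real) \<Rightarrow> ('v \<Rightarrow> real) \<Rightarrow> ('v \<Rightarrow> real) \<Rightarrow> bool"
where
  "steady_state_solution_squared G N vstar pstar q \<eta> P \<longleftrightarrow>
     P vstar = pstar\<^sup>2 \<and> mixture_flow_equations G N q \<eta> P"

end

theory Submission
  imports "HOL-Analysis.Elementary_Metric_Spaces" Defs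
begin

text \<open>
On a connected network the flows that meet the loads form an affine space, whose directions are the
circulations. If there is only one cycle, every circulation is a multiple of the flow \<open>c\<close> of value
\<open>\<plusminus>1\<close> along that cycle (\<open>circulation_multiple_of_unique_cycle\<close>): subtracting a multiple of \<open>c\<close> removes
the flow from one edge of the cycle, and the support of a nonzero circulation would contain a cycle
again. So the candidate flows are \<open>q t = q0 + t * c\<close> for real \<open>t\<close>. By the same fact, prescribed
differences of squared pressures come from a potential as soon as their signed sum around the cycle
vanishes (\<open>potential_exists\<close>). It remains to choose \<open>t\<close> and a composition \<open>\<eta>\<close> that satisfies the
mixing equations for \<open>q t\<close> such that this sum is \<open>0\<close>.

For a given \<open>t\<close> the composition need not be unique, and no choice of it need be continuous in \<open>t\<close>, because
nodes may lose all of their inflow. Therefore no composition is selected as a function of \<open>t\<close>. The mixing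
equations are multiplied by their denominators instead, and the set of all solutions with values in
\<open>[0, 1]\<close> is studied:

  \<^item> it is nonempty, since mixing is a monotone operation on the cube of compositions and has a fixed
    point by the argument of Knaster and Tarski (\<open>mixing_states_nonempty\<close>);
  \<^item> it is convex, and the sum around the cycle is affine in \<open>\<eta>\<close> (\<open>mixing_states_convex\<close>,
    \<open>pressure_rise_convex\<close>);
  \<^item> its graph over \<open>t\<close> is closed (\<open>mixing_states_limit\<close>).

As the cube is compact, the parameters \<open>t\<close> that admit a composition with nonnegative sum, and those that
admit one with nonpositive sum, form two closed sets covering the real line. For \<open>t\<close> large in absolute value all flows
on the cycle run in the same direction around it, the direction of \<open>c\<close> or its opposite according to the sign
of \<open>t\<close>; as pressure falls along the flow (\<open>pressure_rise_opposes_flow\<close>), neither set is empty. As the line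
is connected, some \<open>t\<close> lies in both, and a convex combination of its two compositions makes the
sum vanish (\<open>mixing_intermediate_value\<close>).

The denominators can be divided out again. A node without inflow has no outflow either, by conservation,
so its composition may be reset to the value \<open>0/0 = 0\<close> without affecting any other equation
(\<open>mixture_flow_equations_of_mixing_state\<close>). The equations see only differences of squared pressures;
a constant shift realises the prescribed pressure, and if that pressure is large enough, all squares
are nonnegative.
\<close>

section \<open>Flows and circulations\<close>

definition netflow :: "'v pair_pre_digraph \<Rightarrow> ('v \<times> 'v \<Rightarrow> real) \<Rightarrow> 'v \<Rightarrow> real" where
  "netflow G q v = (\<Sum>e\<in>parcs G. incidence v e * q e)"

lemma netflow_add: "netflow G (\<lambda>e. q e + r e) v = netflow G q v + netflow G r v"
  by (simp add: netflow_def algebra_simps sum.distrib)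

lemma netflow_scale: "netflow G (\<lambda>e. k * q e) v = k * netflow G q v"
  by (simp add: netflow_def sum_distrib_left algebra_simps)

lemma netflow_diff: "netflow G (\<lambda>e. q e - r e) v = netflow G q v - netflow G r v"
  by (simp add: netflow_def algebra_simps sum_subtractf)

lemma netflow_sum: "netflow G (\<lambda>e. \<Sum>i\<in>I. q i e) v = (\<Sum>i\<in>I. netflow G (q i) v)"
  unfolding netflow_def by (simp add: sum_distrib_left sum.swap[of _ "parcs G"])

context pair_digraph
begin

lemma finite_incident_edges: "finite (incident_edges G v)"
  by (rule finite_subset[OF _ pair_finite_arcs]) (auto simp: incident_edges_def)

lemma sum_incident_edges_eq_netflow:
  "(\<Sum>e\<in>incident_edges G v. incidence v e * q e) = netflow G q v"
  unfolding netflow_def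
  by (rule sum.mono_neutral_left[OF pair_finite_arcs])
     (auto simp: incident_edges_def incidence_def)

lemma incidence_eq:
  "e \<in> parcs G \<Longrightarrow> incidence v e = of_bool (snd e = v) - of_bool (fst e = v)"
  using pair_no_loops[of e] by (auto simp: incidence_def)

lemma netflow_single_edge:
  assumes "e \<in> parcs G"
  shows "netflow G (\<lambda>x. of_bool (x = e)) v = of_bool (snd e = v) - of_bool (fst e = v)"
proof -
  have "netflow G (\<lambda>x. of_bool (x = e)) v = (\<Sum>x\<in>parcs G. if x = e then incidence v x else 0)"
    unfolding netflow_def by (intro sum.cong) auto
  then show ?thesis
    using assms pair_finite_arcs by (simp add: incidence_eq)
qed

text \<open>
A path from \<open>u\<close> to \<open>v\<close> may run against the direction of an edge, which then carries \<open>-1\<close>. These flows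
serve twice: superposed, they meet arbitrary balanced loads, and paired with prescribed pressure
differences, they give the potential at \<open>v\<close>.
\<close>

lemma unit_flow_exists:
  assumes "Digraph_Component.connected (with_proj G)" "u \<in> pverts G" "v \<in> pverts G"
  shows "\<exists>f. \<forall>w. netflow G f w = of_bool (w = v) - of_bool (w = u)"
proof -
  have "(u, v) \<in> rtrancl_on (pverts G) (parcs (mk_symmetric (with_proj G)))"
    using assms by (auto simp: connected_def strongly_connected_def reachable_def)
  then show ?thesis
  proof (induct rule: rtrancl_on_induct)
    case base
    show ?case by (rule exI[of _ "\<lambda>_. 0"]) (simp add: netflow_def)
  next
    case (step x y)
    then obtain f where f: "netflow G f w = of_bool (w = x) - of_bool (w = u)" for w
      by blast
    from step consider "(x, y) \<in> parcs G" | "(y, x) \<in> parcs G"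
      by (auto simp: parcs_mk_symmetric)
    then show ?case
    proof cases
      case 1
      then show ?thesis
        by (intro exI[of _ "\<lambda>e. f e + of_bool (e = (x, y))"])
           (auto simp: netflow_add f netflow_single_edge)
    next
      case 2
      then show ?thesis
        by (intro exI[of _ "\<lambda>e. f e - of_bool (e = (y, x))"])
           (auto simp: netflow_diff f netflow_single_edge)
    qed
  qed
qed

lemma wf_digraph_reorient: "wf_digraph (reorient G R)"
  by unfold_locales (auto simp: reorient_def arc_fst_in_verts arc_snd_in_verts)

text \<open>
Relative to the orientation in which the cycle is directed, each of its edges carries one unit, so the
net flow at a node counts arrivals minus departures and telescopes along the walk.
\<close>

lemma circulation_of_cycle:
  assumes "pre_digraph.cycle (reorient G R) p"
  shows "netflow G (\<lambda>e. if e \<in> set p then (if e \<in> R then - 1 else 1) else 0) w = 0"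
proof -
  interpret D: wf_digraph "reorient G R" by (rule wf_digraph_reorient)
  let ?t = "tail (reorient G R)" and ?h = "head (reorient G R)"
  obtain u where u: "D.awalk u p u" and "distinct p"
    using assms unfolding D.cycle_conv by blast
  have telescope: "(\<Sum>e\<leftarrow>p. of_bool (?h e = w) - of_bool (?t e = w)) =
      (of_bool (v = w) - of_bool (u = w) :: real)" if "D.awalk u p v" for u p v
    using that by (induct p arbitrary: u) (auto simp: D.awalk_simps)
  have sub: "set p \<subseteq> parcs G"
    using u unfolding D.awalk_def by (simp add: reorient_def)
  have "netflow G (\<lambda>e. if e \<in> set p then (if e \<in> R then - 1 else 1) else 0) w =
      (\<Sum>e\<in>set p. incidence w e * (if e \<in> R then - 1 else 1))"
    unfolding netflow_def
    by (rule sum.mono_neutral_cong_right[OF pair_finite_arcs sub]) auto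
  also have "\<dots> = (\<Sum>e\<in>set p. of_bool (?h e = w) - of_bool (?t e = w))"
    using sub by (intro sum.cong) (auto simp: incidence_eq reorient_def)
  also have "\<dots> = 0"
    using telescope[OF u] \<open>distinct p\<close> by (simp add: sum_list_distinct_conv_sum_set)
  finally show ?thesis .
qed

text \<open>
Orient every edge in the support along its flow. By conservation, a node that is entered by such an edge
is also left by one, so a walk in the support can be prolonged forever and has to repeat a node.
\<close>

lemma circulation_support_contains_cycle:
  assumes circ: "\<And>v. v \<in> pverts G \<Longrightarrow> netflow G z v = 0"
    and e0: "e0 \<in> parcs G" "z e0 \<noteq> 0"
  shows "\<exists>C. undirected_cycle G C \<and> (\<forall>e\<in>C. z e \<noteq> 0)"
proof -
  define S where "S = {e \<in> parcs G. z e \<noteq> 0}"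
  define R where "R = {e. z e < 0}"
  define H where "H = reorient (G\<lparr>parcs := S\<rparr>) R"
  have H_simps: "verts H = pverts G" "arcs H = S"
      "tail H = (\<lambda>e. if e \<in> R then snd e else fst e)"
      "head H = (\<lambda>e. if e \<in> R then fst e else snd e)"
    by (simp_all add: H_def reorient_def)
  interpret H: wf_digraph H
    by unfold_locales (auto simp: H_simps S_def arc_fst_in_verts arc_snd_in_verts)
  have next_edge: "\<exists>e'\<in>S. tail H e' = head H e" if e: "e \<in> S" for e
  proof -
    let ?v = "head H e"
    have v: "?v \<in> pverts G" using H.head_in_verts[of e] e by (simp add: H_simps)
    have eG: "e \<in> parcs G" using e by (simp add: S_def)
    have pos: "incidence ?v e * z e > 0"
      using e pair_no_loops[OF eG] by (auto simp: H_simps R_def S_def incidence_def)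
    have "\<exists>e'\<in>parcs G. incidence ?v e' * z e' < 0"
    proof (rule ccontr)
      assume "\<not> ?thesis"
      then have "netflow G z ?v > 0"
        unfolding netflow_def
        using pos by (intro sum_pos2[OF pair_finite_arcs eG]) (auto simp: not_less)
      then show False using circ[OF v] by simp
    qed
    then obtain e' where e': "e' \<in> parcs G" "incidence ?v e' * z e' < 0" by blast
    then have "e' \<in> S" "tail H e' = ?v"
      by (auto simp: S_def R_def H_simps(3) incidence_def mult_less_0_iff split: if_splits)
    then show ?thesis by blast
  qed
  have long_walk: "e \<in> S \<Longrightarrow> \<exists>p v. H.awalk (head H e) p v \<and> length p = n" for n e
  proof (induct n arbitrary: e)
    case 0
    then show ?case
      using H.head_in_verts[of e] by (auto simp: H_simps H.awalk_Nil_iff)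
  next
    case (Suc n)
    obtain e' where "e' \<in> S" "tail H e' = head H e" using next_edge[OF Suc.prems] by blast
    moreover obtain p v where "H.awalk (head H e') p v" "length p = n"
      using Suc.hyps[OF \<open>e' \<in> S\<close>] by blast
    ultimately show ?case
      by (intro exI[of _ "e' # p"] exI[of _ v]) (auto simp: H.awalk_Cons_iff H_simps(2))
  qed
  have "e0 \<in> S" using e0 by (simp add: S_def)
  then obtain p v where p: "H.awalk (head H e0) p v" "length p = card (pverts G)"
    using long_walk by blast
  have "\<not> distinct (H.awalk_verts (head H e0) p)"
  proof
    assume "distinct (H.awalk_verts (head H e0) p)"
    then have "Suc (length p) = card (set (H.awalk_verts (head H e0) p))"
      by (simp add: distinct_card H.length_awalk_verts)
    also have "\<dots> \<le> card (pverts G)"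
      using p(1) unfolding H.awalk_conv
      by (intro card_mono[OF pair_finite_verts]) (simp add: H_simps(1))
    finally show False using p(2) by simp
  qed
  from H.awalk_not_distinct_decomp[OF p(1) this] obtain r where "H.closed_w r"
    by (auto simp: H.closed_w_def)
  then obtain c where c: "H.cycle c" using H.closed_w_imp_cycle by blast
  interpret D: wf_digraph "reorient G R" by (rule wf_digraph_reorient)
  have "subgraph H (reorient G R)"
    using H.wf_digraph D.wf_digraph
    by (auto simp: subgraph_def H_simps reorient_def S_def compatible_def)
  then have "D.cycle c" using c by (rule D.subgraph_cycle)
  moreover have "set c \<subseteq> S"
    using c by (auto simp: H.cycle_def H.awalk_def H_simps(2))
  ultimately show ?thesis
    by (intro exI[of _ "set c"]) (auto simp: undirected_cycle_def S_def)
qed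

lemma flow_with_loads_exists:
  assumes conn: "Digraph_Component.connected (with_proj G)" and balance: "(\<Sum>v\<in>pverts G. b v) = 0"
  shows "\<exists>q. \<forall>v\<in>pverts G. netflow G q v = b v"
proof -
  obtain u where u: "u \<in> pverts G"
    using conn by (auto simp: connected_def strongly_connected_def)
  obtain f where f: "netflow G (f v) w = of_bool (w = v) - of_bool (w = u)" if "v \<in> pverts G" for v w
    using unit_flow_exists[OF conn u] by metis
  have "netflow G (\<lambda>e. \<Sum>v\<in>pverts G. b v * f v e) w = b w" if w: "w \<in> pverts G" for w
  proof -
    have "netflow G (\<lambda>e. \<Sum>v\<in>pverts G. b v * f v e) w =
        (\<Sum>v\<in>pverts G. (if v = w then b v else 0) - b v * of_bool (w = u))"
      unfolding netflow_sum netflow_scale by (intro sum.cong) (auto simp: f)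
    also have "\<dots> = b w - (\<Sum>v\<in>pverts G. b v) * of_bool (w = u)"
      using w pair_finite_verts by (simp add: sum_subtractf sum_distrib_right)
    finally show ?thesis using balance by simp
  qed
  then show ?thesis by blast
qed

text \<open>
The multiple is chosen to cancel \<open>z\<close> on one edge of the cycle. What is left is a circulation whose
support misses that edge; a cycle in it would be a second one.
\<close>

lemma circulation_multiple_of_unique_cycle:
  assumes unique: "\<exists>!C. undirected_cycle G C" and C: "undirected_cycle G C"
    and c: "\<And>v. v \<in> pverts G \<Longrightarrow> netflow G c v = 0" "\<And>e. e \<in> C \<Longrightarrow> c e \<noteq> 0"
    and z: "\<And>v. v \<in> pverts G \<Longrightarrow> netflow G z v = 0"
  shows "\<exists>k. \<forall>e\<in>parcs G. z e = k * c e"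
proof -
  have "C \<noteq> {}"
    using C by (auto simp: undirected_cycle_def pre_digraph.cycle_def)
  then obtain e0 where e0: "e0 \<in> C" by blast
  define k where "k = z e0 / c e0"
  have "z e = k * c e" if e: "e \<in> parcs G" for e
  proof (rule ccontr)
    assume "z e \<noteq> k * c e"
    moreover have "netflow G (\<lambda>e. z e - k * c e) v = 0" if "v \<in> pverts G" for v
      using that by (simp add: netflow_diff netflow_scale c z)
    ultimately obtain C' where "undirected_cycle G C'" "\<forall>e\<in>C'. z e - k * c e \<noteq> 0"
      using circulation_support_contains_cycle[of "\<lambda>e. z e - k * c e" e] e by auto
    then have "z e0 - k * c e0 \<noteq> 0" using unique C e0 by blast
    then show False using c(2)[OF e0] by (simp add: k_def)
  qed
  then show ?thesis by blast
qed

text \<open>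
The discrete analogue of integrating a closed form. For an edge \<open>e\<close> from \<open>a\<close> to \<open>b\<close>, the unit flow to \<open>b\<close>
minus the unit flow to \<open>a\<close> minus the flow along \<open>e\<close> is a circulation, hence a multiple of \<open>c\<close>, and \<open>y\<close>
sums to zero against it.
\<close>

lemma potential_exists:
  assumes conn: "Digraph_Component.connected (with_proj G)"
    and spanned: "\<And>z. (\<And>v. v \<in> pverts G \<Longrightarrow> netflow G z v = 0) \<Longrightarrow> \<exists>k. \<forall>e\<in>parcs G. z e = k * c e"
    and orth: "(\<Sum>e\<in>parcs G. c e * y e) = 0"
  shows "\<exists>P. \<forall>e\<in>parcs G. P (snd e) - P (fst e) = y e"
proof -
  obtain u where u: "u \<in> pverts G"
    using conn by (auto simp: connected_def strongly_connected_def)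
  obtain f where f: "netflow G (f v) w = of_bool (w = v) - of_bool (w = u)" if "v \<in> pverts G" for v w
    using unit_flow_exists[OF conn u] by metis
  define P where "P = (\<lambda>v. \<Sum>x\<in>parcs G. f v x * y x)"
  have "P (snd e) - P (fst e) = y e" if e: "e \<in> parcs G" for e
  proof -
    let ?z = "\<lambda>x. f (snd e) x - f (fst e) x - of_bool (x = e)"
    have "netflow G ?z v = 0" for v
      using e by (auto simp: netflow_diff netflow_single_edge f arc_fst_in_verts arc_snd_in_verts)
    then obtain k where k: "\<And>x. x \<in> parcs G \<Longrightarrow> ?z x = k * c x"
      using spanned[of ?z] by blast
    have "P (snd e) - P (fst e) - y e = (\<Sum>x\<in>parcs G. f (snd e) x * y x - f (fst e) x * y x - (if x = e then y x else 0))"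
      using e pair_finite_arcs by (simp add: P_def sum_subtractf)
    also have "\<dots> = (\<Sum>x\<in>parcs G. ?z x * y x)"
      by (intro sum.cong) (auto simp: algebra_simps)
    also have "\<dots> = k * (\<Sum>x\<in>parcs G. c x * y x)"
      by (simp add: k sum_distrib_left mult.assoc)
    finally show ?thesis using orth by simp
  qed
  then show ?thesis by blast
qed

end

section \<open>The pressure law\<close>

text \<open>
Splitting the flow into its positive and negative part shows that the pressure law is jointly continuous in
flow and composition and affine in the composition, also across the removable singularity at zero flow.
\<close>

definition pressure_rise :: "'v gas_data \<Rightarrow> ('v \<times> 'v \<Rightarrow> real) \<Rightarrow> ('v \<Rightarrow> real) \<Rightarrow> 'v \<times> 'v \<Rightarrow> real" where
  "pressure_rise N q \<eta> e = - (friction N / diameter N) * pipe_length N e *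
     (mix_sigma N (\<eta> (fst e)) * (pos_part (q e))\<^sup>2 - mix_sigma N (\<eta> (snd e)) * (neg_part (q e))\<^sup>2)"

lemma edge_sigma_eq_pressure_rise:
  "edge_sigma N e (\<eta> (fst e)) (\<eta> (snd e)) (q e) * (q e * \<bar>q e\<bar>) = pressure_rise N q \<eta> e"
  by (cases "q e" "0::real" rule: linorder_cases)
     (simp_all add: edge_sigma_def pressure_rise_def pos_part_def neg_part_def power2_eq_square)

lemma pos_part_nonneg [simp]: "0 \<le> pos_part x"
  by (simp add: pos_part_def)

lemma neg_part_nonneg [simp]: "0 \<le> neg_part x"
  by (simp add: neg_part_def)

lemma tendsto_pos_part: "(f \<longlongrightarrow> a) F \<Longrightarrow> ((\<lambda>x. pos_part (f x)) \<longlongrightarrow> pos_part a) F"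
  unfolding pos_part_def by (intro tendsto_intros)

lemma tendsto_neg_part: "(f \<longlongrightarrow> a) F \<Longrightarrow> ((\<lambda>x. neg_part (f x)) \<longlongrightarrow> neg_part a) F"
  unfolding neg_part_def by (intro tendsto_intros)

lemma mix_sigma_convex:
  "mix_sigma N ((1 - s) * x + s * y) = (1 - s) * mix_sigma N x + s * mix_sigma N y"
  by (simp add: mix_sigma_def algebra_simps)

lemma mix_sigma_nonneg: "0 \<le> \<eta> \<Longrightarrow> \<eta> \<le> 1 \<Longrightarrow> mix_sigma N \<eta> \<ge> 0"
  by (simp add: mix_sigma_def)

text \<open>
Pressure falls in the direction of the flow, whatever the composition. With \<open>c = \<plusminus>1\<close> on the edges of a
cycle, this decides the sign of the sum around the cycle when the flow runs in one direction around it.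
\<close>

lemma pressure_rise_opposes_flow:
  assumes "friction N > 0" "diameter N > 0" "pipe_length N e > 0"
    and "0 \<le> \<eta> (fst e)" "\<eta> (fst e) \<le> 1" "0 \<le> \<eta> (snd e)" "\<eta> (snd e) \<le> 1"
    and "0 \<le> c * q e"
  shows "c * pressure_rise N q \<eta> e \<le> 0"
proof -
  have nonneg: "0 \<le> friction N / diameter N * pipe_length N e * (mix_sigma N x * (q e)\<^sup>2)"
    if "0 \<le> x" "x \<le> 1" for x
    using assms(1-3) mix_sigma_nonneg[OF that, of N] by simp
  show ?thesis
  proof (cases "q e" "0::real" rule: linorder_cases)
    case less
    then have "pressure_rise N q \<eta> e = friction N / diameter N * pipe_length N e * (mix_sigma N (\<eta> (snd e)) * (q e)\<^sup>2)"
      by (simp add: pressure_rise_def pos_part_def neg_part_def)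
    moreover have "c \<le> 0" using less assms(8) by (simp add: zero_le_mult_iff)
    ultimately show ?thesis
      using nonneg[OF assms(6,7)] by (simp only: mult_nonpos_nonneg)
  next
    case equal
    then show ?thesis by (simp add: pressure_rise_def pos_part_def neg_part_def)
  next
    case greater
    then have "pressure_rise N q \<eta> e = - (friction N / diameter N * pipe_length N e * (mix_sigma N (\<eta> (fst e)) * (q e)\<^sup>2))"
      by (simp add: pressure_rise_def pos_part_def neg_part_def)
    moreover have "c \<ge> 0" using greater assms(8) by (simp add: zero_le_mult_iff)
    ultimately show ?thesis
      using nonneg[OF assms(4,5)] by (simp only: mult_nonneg_nonpos neg_le_0_iff_le)
  qed
qed

lemma pressure_rise_convex:
  "pressure_rise N q (\<lambda>v. (1 - s) * \<eta> v + s * \<eta>' v) e =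
     (1 - s) * pressure_rise N q \<eta> e + s * pressure_rise N q \<eta>' e"
proof -
  have "k * (((1 - s) * a + s * b) * x - ((1 - s) * c + s * d) * y) =
      (1 - s) * (k * (a * x - c * y)) + s * (k * (b * x - d * y))" for k a b c d x y
    by (simp add: algebra_simps)
  then show ?thesis
    unfolding pressure_rise_def mix_sigma_convex .
qed

section \<open>Solutions of the mixing equations\<close>

definition node_inflow ::
  "'v pair_pre_digraph \<Rightarrow> 'v gas_data \<Rightarrow> ('v \<times> 'v \<Rightarrow> real) \<Rightarrow> 'v \<Rightarrow> real" where
  "node_inflow G N q v =
     (\<Sum>e\<in>incident_edges G v. pos_part (incidence v e * q e)) + neg_part (load N v)"

definition hydrogen_inflow ::
  "'v pair_pre_digraph \<Rightarrow> 'v gas_data \<Rightarrow> ('v \<times> 'v \<Rightarrow> real) \<Rightarrow> ('v \<Rightarrow> real) \<Rightarrow> 'v \<Rightarrow> real" where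
  "hydrogen_inflow G N q \<eta> v =
     (\<Sum>e\<in>incident_edges G v. edge_comp q \<eta> e * pos_part (incidence v e * q e))
       + supply_comp N v * neg_part (load N v)"

text \<open>
The mixing equations are multiplied by their denominators. In this form they remain meaningful at nodes
without inflow, whose own composition they leave free, and they pass to limits.
\<close>

definition mixing_states ::
  "'v pair_pre_digraph \<Rightarrow> 'v gas_data \<Rightarrow> ('v \<times> 'v \<Rightarrow> real) \<Rightarrow> ('v \<Rightarrow> real) set" where
  "mixing_states G N q = {\<eta>. \<forall>v\<in>pverts G. 0 \<le> \<eta> v \<and> \<eta> v \<le> 1 \<and>
     \<eta> v * node_inflow G N q v = hydrogen_inflow G N q \<eta> v}"

text \<open>
The jump of \<open>edge_comp\<close> at zero flow is invisible in the hydrogen transport: the right-hand side is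
continuous in \<open>q e\<close>, \<open>\<eta> (fst e)\<close> and \<open>\<eta> (snd e)\<close>.
\<close>

lemma edge_comp_inflow_eq:
  "edge_comp q \<eta> e * pos_part (a * q e) =
     \<eta> (fst e) * pos_part (a * pos_part (q e)) + \<eta> (snd e) * pos_part (- a * neg_part (q e))"
  by (auto simp: edge_comp_def pos_part_def neg_part_def max_def)

lemma hydrogen_inflow_convex:
  "hydrogen_inflow G N q (\<lambda>v. (1 - s) * \<eta> v + s * \<eta>' v) w =
     (1 - s) * hydrogen_inflow G N q \<eta> w + s * hydrogen_inflow G N q \<eta>' w"
proof -
  have *: "edge_comp q (\<lambda>v. (1 - s) * \<eta> v + s * \<eta>' v) e * x =
      (1 - s) * (edge_comp q \<eta> e * x) + s * (edge_comp q \<eta>' e * x)" for e x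
    by (simp add: edge_comp_def algebra_simps)
  show ?thesis
    unfolding hydrogen_inflow_def * sum.distrib sum_distrib_left[symmetric]
    by (simp add: algebra_simps)
qed

lemma mixing_states_convex:
  assumes "\<eta> \<in> mixing_states G N q" "\<eta>' \<in> mixing_states G N q" "0 \<le> s" "s \<le> 1"
  shows "(\<lambda>v. (1 - s) * \<eta> v + s * \<eta>' v) \<in> mixing_states G N q"
  unfolding mixing_states_def
proof (intro CollectI ballI conjI)
  fix v assume v: "v \<in> pverts G"
  let ?x = "(1 - s) * \<eta> v + s * \<eta>' v"
  have *: "0 \<le> \<eta> v" "\<eta> v \<le> 1" "0 \<le> \<eta>' v" "\<eta>' v \<le> 1"
    "\<eta> v * node_inflow G N q v = hydrogen_inflow G N q \<eta> v"
    "\<eta>' v * node_inflow G N q v = hydrogen_inflow G N q \<eta>' v"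
    using assms v by (auto simp: mixing_states_def)
  show "0 \<le> ?x" using * assms by simp
  show "?x \<le> 1" using * assms by (intro convex_bound_le) auto
  show "?x * node_inflow G N q v = hydrogen_inflow G N q (\<lambda>v. (1 - s) * \<eta> v + s * \<eta>' v) v"
    unfolding hydrogen_inflow_convex *(5,6)[symmetric] by (simp add: algebra_simps)
qed

text \<open>
The Knaster-Tarski argument: the pointwise supremum of all \<open>x \<le> T x\<close> in the cube is a fixed point.
\<close>

lemma monotone_unit_cube_fixpoint:
  fixes T :: "('v \<Rightarrow> real) \<Rightarrow> 'v \<Rightarrow> real"
  defines "U \<equiv> {x. \<forall>v. 0 \<le> x v \<and> x v \<le> 1}"
  assumes into: "\<And>x. x \<in> U \<Longrightarrow> T x \<in> U"
    and mono: "\<And>x y. x \<in> U \<Longrightarrow> y \<in> U \<Longrightarrow> x \<le> y \<Longrightarrow> T x \<le> T y"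
  shows "\<exists>x\<in>U. T x = x"
proof -
  define P where "P = {x \<in> U. x \<le> T x}"
  define s where "s = (\<lambda>v. SUP x\<in>P. x v)"
  have zero: "(\<lambda>_. 0) \<in> P"
    using into[of "\<lambda>_. 0"] by (auto simp: P_def U_def le_fun_def)
  have bdd: "bdd_above ((\<lambda>x. x v) ` P)" for v
    by (rule bdd_aboveI2[where M = 1]) (auto simp: P_def U_def)
  have upper: "x \<le> s" if "x \<in> P" for x
    unfolding s_def le_fun_def using that bdd by (auto intro: cSUP_upper)
  have least: "s \<le> y" if "\<And>x. x \<in> P \<Longrightarrow> x \<le> y" for y
    unfolding s_def le_fun_def using zero that
    by (auto intro!: cSUP_least simp: le_fun_def)
  have "s \<le> (\<lambda>_. 1)"
    by (rule least) (auto simp: P_def U_def le_fun_def)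
  with upper[OF zero] have sU: "s \<in> U"
    by (auto simp: U_def le_fun_def)
  have sT: "s \<le> T s"
  proof (rule least)
    fix x assume x: "x \<in> P"
    then have "x \<le> T x" "T x \<le> T s"
      using mono[OF _ sU upper[OF x]] by (auto simp: P_def)
    then show "x \<le> T s" by (rule order_trans)
  qed
  then have "T s \<in> P"
    using mono[OF sU into[OF sU] sT] into[OF sU] by (auto simp: P_def)
  then have "T s = s"
    using upper sT by (auto intro: antisym)
  then show ?thesis using sU by blast
qed

context pair_digraph
begin

text \<open>
Raising the compositions of the incoming gas raises the composition of the mixture, and a mixture of
fractions is a fraction.
\<close>

lemma mixing_states_nonempty:
  assumes comp: "\<And>v. v \<in> pverts G \<Longrightarrow> load N v < 0 \<Longrightarrow> 0 \<le> supply_comp N v \<and> supply_comp N v \<le> 1"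
  shows "mixing_states G N q \<noteq> {}"
proof -
  define T where "T = (\<lambda>\<eta> v. if v \<in> pverts G
      then hydrogen_inflow G N q \<eta> v / node_inflow G N q v else 0)"
  have supply_bounds: "0 \<le> supply_comp N v * neg_part (load N v)"
      "supply_comp N v * neg_part (load N v) \<le> neg_part (load N v)" if "v \<in> pverts G" for v
    using comp[OF that] mult_left_le_one_le[of "neg_part (load N v)" "supply_comp N v"]
    by (cases "load N v < 0"; simp; simp add: neg_part_def)+
  have inflow_nonneg: "0 \<le> node_inflow G N q v" for v
    by (simp add: node_inflow_def sum_nonneg)
  have inflow_mono: "hydrogen_inflow G N q \<eta> v \<le> hydrogen_inflow G N q \<eta>' v" if "\<eta> \<le> \<eta>'" for \<eta> \<eta>' v
    using that unfolding hydrogen_inflow_def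
    by (intro add_mono sum_mono mult_right_mono) (auto simp: edge_comp_def le_fun_def)
  have inflow_bounds: "0 \<le> hydrogen_inflow G N q \<eta> v"
      "hydrogen_inflow G N q \<eta> v \<le> node_inflow G N q v"
    if \<eta>: "\<forall>v. 0 \<le> \<eta> v \<and> \<eta> v \<le> 1" and v: "v \<in> pverts G" for \<eta> v
  proof -
    show "0 \<le> hydrogen_inflow G N q \<eta> v"
      unfolding hydrogen_inflow_def using supply_bounds[OF v] \<eta>
      by (intro add_nonneg_nonneg sum_nonneg) (auto simp: edge_comp_def)
    show "hydrogen_inflow G N q \<eta> v \<le> node_inflow G N q v"
      unfolding hydrogen_inflow_def node_inflow_def using \<eta>
      by (intro add_mono sum_mono supply_bounds(2)[OF v])
         (auto simp: edge_comp_def intro: mult_left_le_one_le)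
  qed
  have "\<exists>\<eta>\<in>{\<eta>. \<forall>v. 0 \<le> \<eta> v \<and> \<eta> v \<le> 1}. T \<eta> = \<eta>"
  proof (rule monotone_unit_cube_fixpoint)
    fix \<eta> :: "'a \<Rightarrow> real" assume "\<eta> \<in> {\<eta>. \<forall>v. 0 \<le> \<eta> v \<and> \<eta> v \<le> 1}"
    then have \<eta>: "\<forall>v. 0 \<le> \<eta> v \<and> \<eta> v \<le> 1" by simp
    have "0 \<le> T \<eta> v \<and> T \<eta> v \<le> 1" for v
    proof (cases "v \<in> pverts G \<and> node_inflow G N q v \<noteq> 0")
      case True
      then have "node_inflow G N q v > 0" using inflow_nonneg[of v] by simp
      then show ?thesis
        using inflow_bounds[OF \<eta>, of v] True by (simp add: T_def)
    qed (auto simp: T_def)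
    then show "T \<eta> \<in> {\<eta>. \<forall>v. 0 \<le> \<eta> v \<and> \<eta> v \<le> 1}" by simp
  next
    fix \<eta> \<eta>' :: "'a \<Rightarrow> real" assume "\<eta> \<le> \<eta>'"
    then show "T \<eta> \<le> T \<eta>'"
      using inflow_mono inflow_nonneg by (auto simp: T_def le_fun_def intro!: divide_right_mono)
  qed
  then obtain \<eta> where \<eta>: "\<forall>v. 0 \<le> \<eta> v \<and> \<eta> v \<le> 1" "T \<eta> = \<eta>" by blast
  have "\<eta> v * node_inflow G N q v = hydrogen_inflow G N q \<eta> v" if v: "v \<in> pverts G" for v
  proof (cases "node_inflow G N q v = 0")
    case True
    then show ?thesis using inflow_bounds[OF \<eta>(1) v] by simp
  next
    case False
    have "\<eta> v = hydrogen_inflow G N q \<eta> v / node_inflow G N q v"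
      using fun_cong[OF \<eta>(2), of v] v by (simp add: T_def)
    then show ?thesis using False by (simp add: field_simps)
  qed
  then have "\<eta> \<in> mixing_states G N q" using \<eta>(1) by (simp add: mixing_states_def)
  then show ?thesis by blast
qed

lemma mixing_states_limit:
  assumes q: "\<And>e. e \<in> parcs G \<Longrightarrow> (\<lambda>n. q n e) \<longlonglongrightarrow> q' e"
    and \<eta>: "\<And>v. v \<in> pverts G \<Longrightarrow> (\<lambda>n. \<eta> n v) \<longlonglongrightarrow> \<eta>' v"
    and states: "\<And>n. \<eta> n \<in> mixing_states G N (q n)"
  shows "\<eta>' \<in> mixing_states G N q'"
  unfolding mixing_states_def
proof (intro CollectI ballI conjI)
  fix v assume v: "v \<in> pverts G"
  have inc: "e \<in> parcs G" "fst e \<in> pverts G" "snd e \<in> pverts G" if "e \<in> incident_edges G v" for e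
    using that by (auto simp: incident_edges_def arc_fst_in_verts arc_snd_in_verts)
  show "0 \<le> \<eta>' v" "\<eta>' v \<le> 1"
    using states v
    by (auto intro!: LIMSEQ_le_const[OF \<eta>[OF v]] LIMSEQ_le_const2[OF \<eta>[OF v]]
        simp: mixing_states_def)
  have "(\<lambda>n. \<eta> n v * node_inflow G N (q n) v) \<longlonglongrightarrow> \<eta>' v * node_inflow G N q' v"
    unfolding node_inflow_def using inc v
    by (intro tendsto_intros tendsto_pos_part q \<eta>) auto
  moreover have "(\<lambda>n. hydrogen_inflow G N (q n) (\<eta> n) v) \<longlonglongrightarrow> hydrogen_inflow G N q' \<eta>' v"
    unfolding hydrogen_inflow_def edge_comp_inflow_eq using inc
    by (intro tendsto_intros tendsto_pos_part tendsto_neg_part q \<eta>) auto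
  moreover have "\<eta> n v * node_inflow G N (q n) v = hydrogen_inflow G N (q n) (\<eta> n) v" for n
    using states[of n] v by (simp add: mixing_states_def)
  ultimately show "\<eta>' v * node_inflow G N q' v = hydrogen_inflow G N q' \<eta>' v"
    by (simp add: LIMSEQ_unique)
qed

lemma bounded_node_functions_subsequence:
  fixes \<eta> :: "nat \<Rightarrow> 'a \<Rightarrow> real"
  assumes "\<And>n v. v \<in> pverts G \<Longrightarrow> \<bar>\<eta> n v\<bar> \<le> B"
  shows "\<exists>\<eta>' r. strict_mono r \<and> (\<forall>v\<in>pverts G. (\<lambda>n. \<eta> (r n) v) \<longlonglongrightarrow> \<eta>' v)"
proof -
  have "\<forall>d\<subseteq>pverts G. \<exists>l::'a \<Rightarrow> real. \<exists>r::nat \<Rightarrow> nat. strict_mono r \<and>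
      (\<forall>\<epsilon>>0. eventually (\<lambda>n. \<forall>i\<in>d. dist (\<eta> (r n) i) (l i) < \<epsilon>) sequentially)"
    by (rule compact_lemma_general[OF pair_finite_verts, where unproj = "\<lambda>x. x"])
       (use assms in \<open>auto simp: bounded_iff image_iff\<close>)
  then obtain l and r :: "nat \<Rightarrow> nat" where r: "strict_mono r"
    and l: "\<And>\<epsilon>. \<epsilon> > 0 \<Longrightarrow> eventually (\<lambda>n. \<forall>i\<in>pverts G. dist (\<eta> (r n) i) (l i) < \<epsilon>) sequentially"
    by blast
  have "(\<lambda>n. \<eta> (r n) v) \<longlonglongrightarrow> l v" if "v \<in> pverts G" for v
  proof (rule tendstoI)
    fix \<epsilon> :: real assume "\<epsilon> > 0"
    from l[OF this] show "eventually (\<lambda>n. dist (\<eta> (r n) v) (l v) < \<epsilon>) sequentially"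
      by (rule eventually_mono) (use that in blast)
  qed
  with r show ?thesis by blast
qed

section \<open>Balancing the cycle\<close>

text \<open>
Mixing states chosen at a convergent sequence of parameters accumulate at a mixing state of the limit
parameter. Weights \<open>k\<close> of either sign make the lemma applicable to both inequalities.
\<close>

lemma closed_parameters_with_mixing_state:
  fixes q :: "real \<Rightarrow> 'a \<times> 'a \<Rightarrow> real"
  assumes q: "\<And>e t. e \<in> parcs G \<Longrightarrow> isCont (\<lambda>t. q t e) t"
  shows "closed {t. \<exists>\<eta>\<in>mixing_states G N (q t). 0 \<le> (\<Sum>e\<in>parcs G. k e * pressure_rise N (q t) \<eta> e)}"
    (is "closed ?A")
  unfolding closed_sequential_limits
proof (intro allI impI)
  fix t l assume *: "(\<forall>n. t n \<in> ?A) \<and> t \<longlonglongrightarrow> l"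
  then have "\<forall>n. \<exists>\<eta>\<in>mixing_states G N (q (t n)). 0 \<le> (\<Sum>e\<in>parcs G. k e * pressure_rise N (q (t n)) \<eta> e)"
    by blast
  then obtain \<eta> where \<eta>: "\<And>n. \<eta> n \<in> mixing_states G N (q (t n))"
      "\<And>n. 0 \<le> (\<Sum>e\<in>parcs G. k e * pressure_rise N (q (t n)) (\<eta> n) e)"
    by metis
  have "\<bar>\<eta> n v\<bar> \<le> 1" if "v \<in> pverts G" for n v
    using \<eta>(1)[of n] that by (auto simp: mixing_states_def)
  then obtain \<eta>' r where r: "strict_mono (r :: nat \<Rightarrow> nat)"
    and lim: "\<And>v. v \<in> pverts G \<Longrightarrow> (\<lambda>n. \<eta> (r n) v) \<longlonglongrightarrow> \<eta>' v"
    using bounded_node_functions_subsequence[of \<eta> 1] by blast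
  have "(\<lambda>n. t (r n)) \<longlonglongrightarrow> l"
    using LIMSEQ_subseq_LIMSEQ[OF _ r, of t l] * by (simp add: o_def)
  then have qlim: "(\<lambda>n. q (t (r n)) e) \<longlonglongrightarrow> q l e" if "e \<in> parcs G" for e
    using isCont_tendsto_compose[OF q[OF that]] by blast
  have "\<eta>' \<in> mixing_states G N (q l)"
    by (rule mixing_states_limit[OF qlim lim \<eta>(1)])
  moreover have "0 \<le> (\<Sum>e\<in>parcs G. k e * pressure_rise N (q l) \<eta>' e)"
  proof (rule LIMSEQ_le_const)
    show "(\<lambda>n. \<Sum>e\<in>parcs G. k e * pressure_rise N (q (t (r n))) (\<eta> (r n)) e)
        \<longlonglongrightarrow> (\<Sum>e\<in>parcs G. k e * pressure_rise N (q l) \<eta>' e)"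
      unfolding pressure_rise_def mix_sigma_def
      by (intro tendsto_intros tendsto_pos_part tendsto_neg_part qlim lim)
         (auto simp: arc_fst_in_verts arc_snd_in_verts)
  qed (use \<eta>(2) in auto)
  ultimately show "l \<in> ?A" by blast
qed

text \<open>
An intermediate value theorem for a set-valued function: its values, the sums over the mixing states of
\<open>q t\<close>, are nonempty and convex, and they depend on \<open>t\<close> with closed graph.
\<close>

lemma mixing_intermediate_value:
  fixes q :: "real \<Rightarrow> 'a \<times> 'a \<Rightarrow> real"
  assumes q: "\<And>e t. e \<in> parcs G \<Longrightarrow> isCont (\<lambda>t. q t e) t"
    and comp: "\<And>v. v \<in> pverts G \<Longrightarrow> load N v < 0 \<Longrightarrow> 0 \<le> supply_comp N v \<and> supply_comp N v \<le> 1"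
    and neg: "\<And>\<eta>. \<eta> \<in> mixing_states G N (q a) \<Longrightarrow> (\<Sum>e\<in>parcs G. k e * pressure_rise N (q a) \<eta> e) \<le> 0"
    and pos: "\<And>\<eta>. \<eta> \<in> mixing_states G N (q b) \<Longrightarrow> (\<Sum>e\<in>parcs G. k e * pressure_rise N (q b) \<eta> e) \<ge> 0"
  shows "\<exists>t. \<exists>\<eta>\<in>mixing_states G N (q t). (\<Sum>e\<in>parcs G. k e * pressure_rise N (q t) \<eta> e) = 0"
proof -
  let ?F = "\<lambda>t \<eta>. \<Sum>e\<in>parcs G. k e * pressure_rise N (q t) \<eta> e"
  let ?A = "{t. \<exists>\<eta>\<in>mixing_states G N (q t). 0 \<le> ?F t \<eta>}"
  let ?B = "{t. \<exists>\<eta>\<in>mixing_states G N (q t). ?F t \<eta> \<le> 0}"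
  have ne: "\<exists>\<eta>. \<eta> \<in> mixing_states G N (q t)" for t
    using mixing_states_nonempty[where N = N and q = "q t"] comp by blast
  have A: "closed ?A"
    by (rule closed_parameters_with_mixing_state[OF q])
  have B: "closed ?B"
    using closed_parameters_with_mixing_state[OF q, where k = "\<lambda>e. - k e"] by (simp add: sum_negf)
  have "t \<in> ?A \<union> ?B" for t
  proof -
    obtain \<eta> where "\<eta> \<in> mixing_states G N (q t)" using ne by blast
    then show ?thesis using linear[of 0 "?F t \<eta>"] by blast
  qed
  then have "UNIV \<subseteq> ?A \<union> ?B" by blast
  moreover have "a \<in> ?B" "b \<in> ?A" using ne neg pos by blast+
  ultimately have "?A \<inter> ?B \<inter> UNIV \<noteq> {}"
    using connected_closedD[OF connected_UNIV _ _ A B] by blast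
  then obtain t \<eta> \<eta>' where t: "\<eta> \<in> mixing_states G N (q t)" "\<eta>' \<in> mixing_states G N (q t)"
      "0 \<le> ?F t \<eta>" "?F t \<eta>' \<le> 0"
    by blast
  \<comment> \<open>The weight at which the segment between the two values meets zero; the case distinction
    covers a segment of length zero.\<close>
  define s where "s = (if ?F t \<eta> = 0 then 0 else ?F t \<eta> / (?F t \<eta> - ?F t \<eta>'))"
  have s: "0 \<le> s" "s \<le> 1" "(1 - s) * ?F t \<eta> + s * ?F t \<eta>' = 0"
    using t(3,4) by (auto simp: s_def field_simps)
  have "?F t (\<lambda>v. (1 - s) * \<eta> v + s * \<eta>' v) = (1 - s) * ?F t \<eta> + s * ?F t \<eta>'"
    unfolding pressure_rise_convex sum_distrib_left sum.distrib[symmetric]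
    by (intro sum.cong) (simp_all add: algebra_simps)
  then show ?thesis
    using mixing_states_convex[OF t(1,2) s(1,2)] s(3) by (intro exI bexI) auto
qed

section \<open>Existence of solutions\<close>

text \<open>
Without inflow all terms of the node balance are nonpositive, while their sum, the load, is nonnegative
because nothing is supplied at the node.
\<close>

lemma no_flow_at_node_without_inflow:
  assumes "netflow G q v = load N v" "node_inflow G N q v = 0" "e \<in> incident_edges G v"
  shows "q e = 0"
proof -
  have "0 \<le> (\<Sum>e\<in>incident_edges G v. pos_part (incidence v e * q e))"
    by (intro sum_nonneg) simp
  then have zero: "(\<Sum>e\<in>incident_edges G v. pos_part (incidence v e * q e)) = 0" "neg_part (load N v) = 0"
    using assms(2) neg_part_nonneg[of "load N v"] unfolding node_inflow_def by linarith+
  then have out: "incidence v e * q e \<le> 0" if "e \<in> incident_edges G v" for e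
  proof -
    have "pos_part (incidence v e * q e) = 0"
      using zero(1) that finite_incident_edges[of v] by (simp add: sum_nonneg_eq_0_iff)
    then show ?thesis by (simp add: pos_part_def max_def split: if_splits)
  qed
  have "0 \<le> (\<Sum>e\<in>incident_edges G v. incidence v e * q e)"
    using zero(2) assms(1) by (simp add: sum_incident_edges_eq_netflow neg_part_def max_def split: if_splits)
  moreover have "(\<Sum>e\<in>incident_edges G v. incidence v e * q e) \<le> 0"
    by (rule sum_nonpos) (rule out)
  ultimately have "incidence v e * q e = 0"
    using sum_nonneg_eq_0_iff[of "incident_edges G v" "\<lambda>e. - (incidence v e * q e)"]
      finite_incident_edges[of v] out assms(3) by (auto simp: sum_negf)
  moreover have "incidence v e \<noteq> 0" using assms(3) by (auto simp: incident_edges_def incidence_def)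
  ultimately show ?thesis by simp
qed

text \<open>
Passing back to quotients changes a composition only at nodes without inflow, and there all incident
edges carry zero flow.
\<close>

lemma mixture_flow_equations_of_mixing_state:
  assumes flow: "\<And>v. v \<in> pverts G \<Longrightarrow> netflow G q v = load N v"
    and \<eta>: "\<eta> \<in> mixing_states G N q"
    and P: "\<And>e. e \<in> parcs G \<Longrightarrow> P (snd e) - P (fst e) = pressure_rise N q \<eta> e"
  shows "\<exists>\<eta>'. mixture_flow_equations G N q \<eta>' P"
proof -
  define \<eta>' where "\<eta>' = (\<lambda>v. if node_inflow G N q v = 0 then 0 else \<eta> v)"
  have agree: "q e = 0 \<or> \<eta>' v = \<eta> v" if "e \<in> parcs G" "v = fst e \<or> v = snd e" for e v
  proof -
    have "e \<in> incident_edges G v" "v \<in> pverts G"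
      using that by (auto simp: incident_edges_def arc_fst_in_verts arc_snd_in_verts)
    then show ?thesis
      using no_flow_at_node_without_inflow[where q = q and N = N and v = v and e = e] flow by (auto simp: \<eta>'_def)
  qed
  have rise: "pressure_rise N q \<eta>' e = pressure_rise N q \<eta> e" if "e \<in> parcs G" for e
    using agree[OF that, of "fst e"] agree[OF that, of "snd e"]
    by (auto simp: pressure_rise_def pos_part_def neg_part_def)
  have "edge_comp q \<eta>' e * pos_part (incidence v e * q e) = edge_comp q \<eta> e * pos_part (incidence v e * q e)"
    if "e \<in> parcs G" for e v
    using agree[OF that, of "fst e"] agree[OF that, of "snd e"]
    by (auto simp: edge_comp_def pos_part_def)
  then have inflow: "hydrogen_inflow G N q \<eta>' v = hydrogen_inflow G N q \<eta> v" for v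
    unfolding hydrogen_inflow_def by (intro arg_cong2[where f = "(+)"] sum.cong) (auto simp: incident_edges_def)
  have "\<eta>' v = hydrogen_inflow G N q \<eta>' v / node_inflow G N q v" if "v \<in> pverts G" for v
    using \<eta> that unfolding inflow by (auto simp: mixing_states_def \<eta>'_def field_simps)
  then have "mixture_flow_equations G N q \<eta>' P"
    using flow P
    unfolding mixture_flow_equations_def edge_sigma_eq_pressure_rise sum_incident_edges_eq_netflow
      hydrogen_inflow_def[symmetric] node_inflow_def[symmetric]
    by (simp add: rise)
  then show ?thesis by blast
qed

lemma mixture_flow_exists:
  assumes conn: "Digraph_Component.connected (with_proj G)"
    and unique: "\<exists>!C. undirected_cycle G C"
    and par: "friction N > 0" "diameter N > 0" "\<And>e. e \<in> parcs G \<Longrightarrow> pipe_length N e > 0"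
    and balance: "(\<Sum>v\<in>pverts G. load N v) = 0"
    and comp: "\<And>v. v \<in> pverts G \<Longrightarrow> load N v < 0 \<Longrightarrow> 0 \<le> supply_comp N v \<and> supply_comp N v \<le> 1"
  shows "\<exists>q \<eta> P. mixture_flow_equations G N q \<eta> P"
proof -
  obtain R p where p: "pre_digraph.cycle (reorient G R) p"
    using unique by (auto simp: undirected_cycle_def)
  define c :: "'a \<times> 'a \<Rightarrow> real" where
    "c = (\<lambda>e. if e \<in> set p then (if e \<in> R then - 1 else 1) else 0)"
  have c: "netflow G c v = 0" for v
    unfolding c_def by (rule circulation_of_cycle[OF p])
  obtain q0 where q0: "\<And>v. v \<in> pverts G \<Longrightarrow> netflow G q0 v = load N v"
    using flow_with_loads_exists[OF conn balance] by blast
  define q where "q = (\<lambda>t e. q0 e + t * c e)"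
  have flow: "netflow G (q t) v = load N v" if "v \<in> pverts G" for t v
    using that unfolding q_def netflow_add netflow_scale by (simp add: c q0)
  \<comment> \<open>At the parameters \<open>T\<close> and \<open>- T\<close> the flow \<open>q0\<close> cannot reverse the circulation on any edge of the cycle.\<close>
  define T where "T = (\<Sum>e\<in>parcs G. \<bar>q0 e\<bar>)"
  have T: "\<bar>q0 e\<bar> \<le> T" if "e \<in> parcs G" for e
    unfolding T_def using that pair_finite_arcs by (intro member_le_sum) auto
  have "\<exists>t. \<exists>\<eta>\<in>mixing_states G N (q t). (\<Sum>e\<in>parcs G. c e * pressure_rise N (q t) \<eta> e) = 0"
  proof (rule mixing_intermediate_value)
    show "isCont (\<lambda>t. q t e) t" for e t
      unfolding q_def by (intro continuous_intros)
  next
    fix \<eta> assume \<eta>: "\<eta> \<in> mixing_states G N (q T)"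
    show "(\<Sum>e\<in>parcs G. c e * pressure_rise N (q T) \<eta> e) \<le> 0"
    proof (intro sum_nonpos pressure_rise_opposes_flow par)
      fix e assume e: "e \<in> parcs G"
      show "0 \<le> c e * q T e" using T[OF e] by (auto simp: q_def c_def)
    qed (use \<eta> in \<open>auto simp: mixing_states_def arc_fst_in_verts arc_snd_in_verts\<close>)
  next
    fix \<eta> assume \<eta>: "\<eta> \<in> mixing_states G N (q (- T))"
    have "- c e * pressure_rise N (q (- T)) \<eta> e \<le> 0" if e: "e \<in> parcs G" for e
    proof (intro pressure_rise_opposes_flow par e)
      show "0 \<le> - c e * q (- T) e" using T[OF e] by (auto simp: q_def c_def)
    qed (use \<eta> e in \<open>auto simp: mixing_states_def arc_fst_in_verts arc_snd_in_verts\<close>)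
    then show "0 \<le> (\<Sum>e\<in>parcs G. c e * pressure_rise N (q (- T)) \<eta> e)"
      by (intro sum_nonneg) simp
  qed (fact comp)
  then obtain t \<eta> where \<eta>: "\<eta> \<in> mixing_states G N (q t)"
    and loop: "(\<Sum>e\<in>parcs G. c e * pressure_rise N (q t) \<eta> e) = 0"
    by blast
  have "undirected_cycle G (set p)" using p by (auto simp: undirected_cycle_def)
  have spanned: "\<exists>k. \<forall>e\<in>parcs G. z e = k * c e"
    if z: "\<And>v. v \<in> pverts G \<Longrightarrow> netflow G z v = 0" for z
  proof (rule circulation_multiple_of_unique_cycle[OF unique \<open>undirected_cycle G (set p)\<close>])
    show "c e \<noteq> 0" if "e \<in> set p" for e using that by (simp add: c_def)
  qed (use c z in auto)
  obtain P where "\<And>e. e \<in> parcs G \<Longrightarrow> P (snd e) - P (fst e) = pressure_rise N (q t) \<eta> e"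
    using potential_exists[OF conn spanned loop] by blast
  then show ?thesis
    using mixture_flow_equations_of_mixing_state[OF flow \<eta>] by blast
qed

end

lemma mixture_flow_equations_shift:
  assumes "pair_digraph G" "mixture_flow_equations G N q \<eta> P" "\<And>v. v \<in> pverts G \<Longrightarrow> P' v = P v + k"
  shows "mixture_flow_equations G N q \<eta> P'"
proof -
  interpret pair_digraph G by fact
  show ?thesis
    using assms(2) unfolding mixture_flow_equations_def
    by (simp add: assms(3) arc_fst_in_verts arc_snd_in_verts)
qed

theorem theorem3p6:
  fixes G :: "'v pair_pre_digraph" and N :: "'v gas_data" and vstar :: 'v
  assumes "pair_digraph G"
    and "Digraph_Component.connected (with_proj G)"
    and "\<exists>!C. undirected_cycle G C"
    and "friction N > 0" and "diameter N > 0"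
    and "sound_H2 N > 0" and "sound_NG N > 0"
    and "\<forall>e\<in>parcs G. pipe_length N e > 0"
    and "(\<Sum>v\<in>pverts G. load N v) = 0"
    and "\<forall>v\<in>pverts G. load N v < 0 \<longrightarrow> 0 \<le> supply_comp N v \<and> supply_comp N v \<le> 1"
    and "vstar \<in> pverts G"
  shows "(\<forall>pstar. \<exists>q \<eta> P. steady_state_solution_squared G N vstar pstar q \<eta> P) \<and>
         (\<exists>pmin. \<forall>pstar\<ge>pmin. \<exists>q \<eta> p. steady_state_solution G N vstar pstar q \<eta> p)"
proof -
  interpret pair_digraph G by fact
  obtain q \<eta> P0 where "mixture_flow_equations G N q \<eta> P0"
    using mixture_flow_exists[OF assms(2-5) _ assms(9)] assms(8,10) by blast
  then have "mixture_flow_equations G N q \<eta> (\<lambda>v. P0 v - P0 vstar)"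
    by (rule mixture_flow_equations_shift[OF assms(1)]) simp
  then obtain P where P: "mixture_flow_equations G N q \<eta> P" "P vstar = 0"
    by (metis diff_self)
  \<comment> \<open>The summand 1 makes \<open>pmin \<ge> 1\<close>, so that \<open>pstar\<^sup>2 \<ge> pstar\<close> dominates every \<open>\<bar>P v\<bar>\<close>.\<close>
  define pmin where "pmin = 1 + (\<Sum>v\<in>pverts G. \<bar>P v\<bar>)"
  have real_pressures: "\<exists>q \<eta> p. steady_state_solution G N vstar pstar q \<eta> p" if pstar: "pstar \<ge> pmin" for pstar
  proof -
    have "pmin \<ge> 1"
      unfolding pmin_def by (simp add: sum_nonneg)
    have nonneg: "0 \<le> P v + pstar\<^sup>2" if v: "v \<in> pverts G" for v
    proof -
      have "- P v \<le> \<bar>P v\<bar>" by simp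
      also have "\<dots> \<le> (\<Sum>v\<in>pverts G. \<bar>P v\<bar>)"
        using v pair_finite_verts by (intro member_le_sum) auto
      also have "\<dots> \<le> pstar" using pstar by (simp add: pmin_def)
      also have "\<dots> \<le> pstar\<^sup>2"
        using pstar \<open>pmin \<ge> 1\<close> by (intro self_le_power) auto
      finally show ?thesis by simp
    qed
    let ?p = "\<lambda>v. sqrt (P v + pstar\<^sup>2)"
    have "mixture_flow_equations G N q \<eta> (\<lambda>v. (?p v)\<^sup>2)"
      by (rule mixture_flow_equations_shift[OF assms(1) P(1)]) (simp add: nonneg)
    moreover have "?p vstar = pstar" using P(2) pstar \<open>pmin \<ge> 1\<close> by simp
    ultimately have "steady_state_solution G N vstar pstar q \<eta> ?p"
      by (simp add: steady_state_solution_def)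
    then show ?thesis by blast
  qed
  have "steady_state_solution_squared G N vstar pstar q \<eta> (\<lambda>v. P v + pstar\<^sup>2)" for pstar
    using mixture_flow_equations_shift[OF assms(1) P(1), where k = "pstar\<^sup>2"] P(2)
    by (simp add: steady_state_solution_squared_def)
  with real_pressures show ?thesis by blast
qed

end
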